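(* Let $r\geq 2$ be a positive integer. Let $q\equiv 1\pmod{r}$ be a prime power, with $p=\operatorname{char}(\mathbb{F}_q)$, such that $q>r^4$ and $p \nmid (r^2-1)$. Let $k\in\mathbb{F}_q^*$ be such that $-k$ is not an $r$-th power in $\mathbb{F}_q^*$, and set $m=\frac{q-1}{r}$. Then the plane curve $C$ over $\mathbb{F}_q$ defined by $$ -(ky+z)x^{m}+ z y^m + ky z^m = 0 $$ is smooth and nontrivially blocking.
   Context: A plane curve $C=\{F=0\}\subset\mathbb{P}^2$ over $\mathbb{F}_q$ is given by a nonzero homogeneous polynomial $F\in\mathbb{F}_q[x,y,z]$. It is smooth if at every point $P\in C$ (over $\overline{\mathbb{F}_q}$) at least one of the partial derivatives $F_x,F_y,F_z$ does not vanish. $C(\mathbb{F}_q)$ is the set of points $[x:y:z]\in\mathbb{P}^2(\mathbb{F}_q)$ with $F(x,y,z)=0$. A set $B\subseteq\mathbb{P}^2(\mathbb{F}_q)$ is a blocking set if every line of $\mathbb{P}^2$ defined over $\mathbb{F}_q$ (an $\mathbb{F}_q$-line) contains a point of $B$; it is a nontrivial blocking set if moreover it does not contain all the $\mathbb{F}_q$-points of any $\mathbb{F}_q$-line. The curve $C$ is nontrivially blocking if $C(\mathbb{F}_q)$ is a nontrivial blocking set. *)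

theory Defs
  imports
    "HOL-Algebra.Algebraic_Closure_Type"
    "HOL-Library.Poly_Mapping"
    "HOL-Library.Product_Plus"
    "HOL-Library.Cardinality"
    "HOL-Number_Theory.Cong"
begin

text \<open>
  Polynomials in \<open>x, y, z\<close>: the key \<open>(a, b, c)\<close> is the exponent vector of the monomial
  \<open>x^a y^b z^c\<close>. Multiplication is the convolution product of \<open>Poly_Mapping\<close> over the additive
  monoid of exponent triples.
\<close>
type_synonym 'a poly3 = "(nat \<times> nat \<times> nat) \<Rightarrow>\<^sub>0 'a"

definition Const :: "'a::zero \<Rightarrow> 'a poly3" where
  "Const c = Poly_Mapping.single (0, 0, 0) c"

definition VarX :: "'a::zero_neq_one poly3" where
  "VarX = Poly_Mapping.single (1, 0, 0) 1"

definition VarY :: "'a::zero_neq_one poly3" where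
  "VarY = Poly_Mapping.single (0, 1, 0) 1"

definition VarZ :: "'a::zero_neq_one poly3" where
  "VarZ = Poly_Mapping.single (0, 0, 1) 1"

definition eval3 :: "'a::comm_semiring_1 poly3 \<Rightarrow> 'a \<times> 'a \<times> 'a \<Rightarrow> 'a" where
  "eval3 F = (\<lambda>(x, y, z). \<Sum>(a, b, c)\<in>Poly_Mapping.keys F.
     Poly_Mapping.lookup F (a, b, c) * x ^ a * y ^ b * z ^ c)"

definition homogeneous3 :: "nat \<Rightarrow> 'a::zero poly3 \<Rightarrow> bool" where
  "homogeneous3 d F \<longleftrightarrow> (\<forall>(a, b, c)\<in>Poly_Mapping.keys F. a + b + c = d)"

text \<open>In the terms with \<open>a = 0\<close> the truncated exponent is harmless: the coefficient is \<open>0\<close>.\<close>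
definition deriv_x :: "'a::comm_semiring_1 poly3 \<Rightarrow> 'a poly3" where
  "deriv_x F = (\<Sum>(a, b, c)\<in>Poly_Mapping.keys F.
     Poly_Mapping.single (a - 1, b, c) (of_nat a * Poly_Mapping.lookup F (a, b, c)))"

definition deriv_y :: "'a::comm_semiring_1 poly3 \<Rightarrow> 'a poly3" where
  "deriv_y F = (\<Sum>(a, b, c)\<in>Poly_Mapping.keys F.
     Poly_Mapping.single (a, b - 1, c) (of_nat b * Poly_Mapping.lookup F (a, b, c)))"

definition deriv_z :: "'a::comm_semiring_1 poly3 \<Rightarrow> 'a poly3" where
  "deriv_z F = (\<Sum>(a, b, c)\<in>Poly_Mapping.keys F.
     Poly_Mapping.single (a, b, c - 1) (of_nat c * Poly_Mapping.lookup F (a, b, c)))"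

text \<open>A projective point is the set of all its homogeneous coordinate vectors.\<close>
definition proj_rel :: "(('a::field \<times> 'a \<times> 'a) \<times> ('a \<times> 'a \<times> 'a)) set" where
  "proj_rel = {((x, y, z), (x', y', z')). (x, y, z) \<noteq> (0, 0, 0) \<and>
     (\<exists>t. t \<noteq> 0 \<and> x' = t * x \<and> y' = t * y \<and> z' = t * z)}"

lemma equiv_proj_rel: "equiv (UNIV - {(0, 0, 0)}) (proj_rel :: (('a::field \<times> 'a \<times> 'a) \<times> _) set)"
proof (rule equivI)
  show "refl_on (UNIV - {(0, 0, 0)}) (proj_rel :: (('a \<times> 'a \<times> 'a) \<times> _) set)"
    by (auto simp: refl_on_def proj_rel_def intro!: exI[of _ 1])
  show "sym (proj_rel :: (('a \<times> 'a \<times> 'a) \<times> _) set)"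
  proof (rule symI)
    fix u v :: "'a \<times> 'a \<times> 'a"
    assume "(u, v) \<in> proj_rel"
    then obtain x y z t where "u = (x, y, z)" "v = (t * x, t * y, t * z)" "t \<noteq> 0"
      "(x, y, z) \<noteq> (0, 0, 0)"
      by (auto simp: proj_rel_def)
    then show "(v, u) \<in> proj_rel"
      by (auto simp: proj_rel_def field_simps intro!: exI[of _ "inverse t"])
  qed
  show "trans (proj_rel :: (('a \<times> 'a \<times> 'a) \<times> _) set)"
  proof (rule transI)
    fix u v w :: "'a \<times> 'a \<times> 'a"
    assume "(u, v) \<in> proj_rel" "(v, w) \<in> proj_rel"
    then obtain x y z t where *: "u = (x, y, z)" "v = (t * x, t * y, t * z)" "t \<noteq> 0"
      "(x, y, z) \<noteq> (0, 0, 0)"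
      by (auto simp: proj_rel_def)
    from \<open>(v, w) \<in> proj_rel\<close> obtain s where
      "w = (s * (t * x), s * (t * y), s * (t * z))" "s \<noteq> 0"
      by (cases w) (auto simp: proj_rel_def *)
    with * show "(u, w) \<in> proj_rel"
      by (auto simp: proj_rel_def mult.assoc intro!: exI[of _ "s * t"])
  qed
qed (auto simp: proj_rel_def)

definition proj_plane :: "('a::field \<times> 'a \<times> 'a) set set" where
  "proj_plane = (UNIV - {(0, 0, 0)}) // proj_rel"

definition plane_curve :: "'a::field poly3 \<Rightarrow> bool" where
  "plane_curve F \<longleftrightarrow> F \<noteq> 0 \<and> (\<exists>d. homogeneous3 d F)"

text \<open>
  For homogeneous \<open>F\<close>, whether \<open>F\<close> vanishes at a point does not depend on the chosen coordinate
  vector.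
\<close>
definition curve_points :: "'a::field poly3 \<Rightarrow> ('a \<times> 'a \<times> 'a) set set" where
  "curve_points F = {P \<in> proj_plane. \<forall>v\<in>P. eval3 F v = 0}"

definition base_change :: "'a::field poly3 \<Rightarrow> 'a alg_closure poly3" where
  "base_change F = Poly_Mapping.map to_ac F"

definition smooth_curve :: "'a::field poly3 \<Rightarrow> bool" where
  "smooth_curve F \<longleftrightarrow> (\<forall>P\<in>curve_points (base_change F). \<forall>v\<in>P.
     eval3 (deriv_x (base_change F)) v \<noteq> 0 \<or>
     eval3 (deriv_y (base_change F)) v \<noteq> 0 \<or>
     eval3 (deriv_z (base_change F)) v \<noteq> 0)"

text \<open>The rational points of the line \<open>a x + b y + c z = 0\<close>.\<close>
definition line_points :: "'a::field \<times> 'a \<times> 'a \<Rightarrow> ('a \<times> 'a \<times> 'a) set set" where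
  "line_points = (\<lambda>(a, b, c).
     {P \<in> proj_plane. \<forall>(x, y, z)\<in>P. a * x + b * y + c * z = 0})"

definition lines :: "('a::field \<times> 'a \<times> 'a) set set set" where
  "lines = line_points ` (UNIV - {(0, 0, 0)})"

definition blocking_set :: "('a::field \<times> 'a \<times> 'a) set set \<Rightarrow> bool" where
  "blocking_set B \<longleftrightarrow> B \<subseteq> proj_plane \<and> (\<forall>L\<in>lines. L \<inter> B \<noteq> {})"

definition nontrivial_blocking_set :: "('a::field \<times> 'a \<times> 'a) set set \<Rightarrow> bool" where
  "nontrivial_blocking_set B \<longleftrightarrow> blocking_set B \<and> (\<forall>L\<in>lines. \<not> L \<subseteq> B)"

definition nontrivially_blocking :: "'a::field poly3 \<Rightarrow> bool" where
  "nontrivially_blocking F \<longleftrightarrow> nontrivial_blocking_set (curve_points F)"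

end

theory Submission
  imports Defs "HOL-Number_Theory.Residues"
begin

text \<open>
  Since \<open>r m = q - 1\<close>, we have \<open>m = - 1 / r\<close> in the field, so \<open>m\<^sup>2 \<noteq> 1\<close> there; a singular point would
  force \<open>m\<^sup>2 = 1\<close> or \<open>(- k)^m = 1\<close>, and the latter says that \<open>- k\<close> is an \<open>r\<close>-th power.

  The rational points \<open>[x : y : z]\<close> with \<open>x^m = y^m = z^m\<close> lie on the curve and meet every line
  \<open>a x + b y + c z = 0\<close> with \<open>a b c \<noteq> 0\<close>, by a second moment estimate; the remaining lines pass
  through a coordinate vertex. The line \<open>z = - k y\<close> meets the curve only in \<open>[1 : 0 : 0]\<close>, so a line
  inside the curve would pass through that vertex, and then it would have to be \<open>z = - k y\<close> itself.
\<close>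

section \<open>Sums over the terms of a polynomial\<close>

text \<open>Cancellation can remove keys from \<open>F + G\<close>, so all three sums are extended
  to the union of the two key sets; the added terms vanish because \<open>g i 0 = 0\<close>.\<close>

lemma sum_keys_add:
  fixes g :: "'k \<Rightarrow> 'a::comm_monoid_add \<Rightarrow> 'b::comm_monoid_add" and F G :: "'k \<Rightarrow>\<^sub>0 'a"
  assumes zero: "\<And>i. g i 0 = 0" and add: "\<And>i a b. g i (a + b) = g i a + g i b"
  shows "(\<Sum>i\<in>Poly_Mapping.keys (F + G). g i (Poly_Mapping.lookup (F + G) i)) =
    (\<Sum>i\<in>Poly_Mapping.keys F. g i (Poly_Mapping.lookup F i)) +
    (\<Sum>i\<in>Poly_Mapping.keys G. g i (Poly_Mapping.lookup G i))"
proof -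
  let ?S = "Poly_Mapping.keys F \<union> Poly_Mapping.keys G"
  have superset: "(\<Sum>i\<in>Poly_Mapping.keys H. g i (Poly_Mapping.lookup H i)) =
      (\<Sum>i\<in>?S. g i (Poly_Mapping.lookup H i))" if "Poly_Mapping.keys H \<subseteq> ?S" for H
    using that by (intro sum.mono_neutral_left) (auto simp: zero in_keys_iff)
  show ?thesis
    unfolding superset[OF keys_add] superset[OF Un_upper1] superset[OF Un_upper2]
    by (simp only: lookup_add add sum.distrib)
qed

lemma eval3_add: "eval3 (F + G) v = eval3 F v + eval3 G v"
proof (cases v)
  case (fields x y z)
  show ?thesis
    using sum_keys_add[of "\<lambda>(a, b, c) u. u * x ^ a * y ^ b * z ^ c" F G]
    by (simp add: eval3_def fields case_prod_unfold algebra_simps)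
qed

lemma eval3_single: "eval3 (Poly_Mapping.single (a, b, c) u) (x, y, z) = u * x ^ a * y ^ b * z ^ c"
  by (simp add: eval3_def)

lemma deriv_x_add: "deriv_x (F + G) = deriv_x F + deriv_x G"
  using sum_keys_add[of "\<lambda>(a, b, c) u. Poly_Mapping.single (a - 1, b, c) (of_nat a * u)" F G]
  by (simp add: deriv_x_def case_prod_unfold distrib_left single_add)

lemma deriv_y_add: "deriv_y (F + G) = deriv_y F + deriv_y G"
  using sum_keys_add[of "\<lambda>(a, b, c) u. Poly_Mapping.single (a, b - 1, c) (of_nat b * u)" F G]
  by (simp add: deriv_y_def case_prod_unfold distrib_left single_add)

lemma deriv_z_add: "deriv_z (F + G) = deriv_z F + deriv_z G"
  using sum_keys_add[of "\<lambda>(a, b, c) u. Poly_Mapping.single (a, b, c - 1) (of_nat c * u)" F G]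
  by (simp add: deriv_z_def case_prod_unfold distrib_left single_add)

lemma deriv_single:
  "deriv_x (Poly_Mapping.single (a, b, c) u) = Poly_Mapping.single (a - 1, b, c) (of_nat a * u)"
  "deriv_y (Poly_Mapping.single (a, b, c) u) = Poly_Mapping.single (a, b - 1, c) (of_nat b * u)"
  "deriv_z (Poly_Mapping.single (a, b, c) u) = Poly_Mapping.single (a, b, c - 1) (of_nat c * u)"
  by (simp_all add: deriv_x_def deriv_y_def deriv_z_def)

text \<open>\<open>Poly_Mapping.map\<close> acts on nonzero coefficients only; since
  \<open>to_ac 0 = 0\<close>, this restriction is harmless and additivity comes from
  \<open>to_ac\<close>.\<close>

lemma base_change_add: "base_change (F + G) = base_change F + base_change G"
  by (rule poly_mapping_eqI)
    (auto simp: base_change_def Poly_Mapping.map.rep_eq lookup_add when_def simp flip: to_ac_add)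

lemma base_change_single: "base_change (Poly_Mapping.single v u) = Poly_Mapping.single v (to_ac u)"
  by (simp add: base_change_def)

lemma single_power:
  "Poly_Mapping.single v (1::'a::comm_semiring_1) ^ n =
    Poly_Mapping.single (n * fst v, n * fst (snd v), n * snd (snd v)) 1"
proof (induction n)
  case 0
  then show ?case
    by (simp flip: single_one zero_prod_def)
next
  case (Suc n)
  then show ?case
    by (cases v) (simp add: mult_single)
qed

lemma homogeneous3_add: "homogeneous3 d F \<Longrightarrow> homogeneous3 d G \<Longrightarrow> homogeneous3 d (F + G)"
  using keys_add[of F G] by (fastforce simp: homogeneous3_def)

lemma homogeneous3_single:
  "a + b + c = d \<Longrightarrow> homogeneous3 d (Poly_Mapping.single (a, b, c) u)"
  by (simp add: homogeneous3_def)

lemma eval3_homogeneous: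
  assumes "homogeneous3 d F"
  shows "eval3 F (t * x, t * y, t * z) = t ^ d * eval3 F (x, y, z)"
proof -
  have "(case i of (a, b, c) \<Rightarrow>
        Poly_Mapping.lookup F (a, b, c) * (t * x) ^ a * (t * y) ^ b * (t * z) ^ c) =
      t ^ d * (case i of (a, b, c) \<Rightarrow> Poly_Mapping.lookup F (a, b, c) * x ^ a * y ^ b * z ^ c)"
    if "i \<in> Poly_Mapping.keys F" for i
  proof (cases i)
    case (fields a b c)
    with that assms have "d = a + b + c"
      by (auto simp: homogeneous3_def)
    then show ?thesis
      by (simp add: fields power_mult_distrib power_add mult_ac)
  qed
  then show ?thesis
    unfolding eval3_def sum_distrib_left case_prod_conv by (intro sum.cong) auto
qed

section \<open>Points in homogeneous coordinates\<close>

abbreviation proj_point :: "'a::field \<times> 'a \<times> 'a \<Rightarrow> ('a \<times> 'a \<times> 'a) set" where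
  "proj_point v \<equiv> proj_rel `` {v}"

lemma proj_point_eq:
  assumes "(x, y, z) \<noteq> (0, 0, 0)"
  shows "proj_point (x, y, z) = {(t * x, t * y, t * z) | t. t \<noteq> 0}"
  using assms by (auto simp: proj_rel_def)

lemma proj_point_in_plane: "v \<noteq> (0, 0, 0) \<Longrightarrow> proj_point v \<in> proj_plane"
  unfolding proj_plane_def by (intro quotientI) auto

lemma coordinates_nonzero: "v \<in> P \<Longrightarrow> P \<in> proj_plane \<Longrightarrow> v \<noteq> (0, 0, 0)"
  by (auto simp: proj_plane_def quotient_def proj_rel_def)

lemma proj_point_on_line_iff:
  assumes "(x, y, z) \<noteq> (0, 0, 0)"
  shows "proj_point (x, y, z) \<in> line_points (a, b, c) \<longleftrightarrow> a * x + b * y + c * z = 0"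
proof -
  have "a * (t * x) + b * (t * y) + c * (t * z) = t * (a * x + b * y + c * z)" for t
    by (simp add: algebra_simps)
  then show ?thesis
    using assms proj_point_in_plane[OF assms]
    by (auto simp: line_points_def proj_point_eq)
qed

lemma proj_point_on_curve_iff:
  assumes "homogeneous3 d F" "(x, y, z) \<noteq> (0, 0, 0)"
  shows "proj_point (x, y, z) \<in> curve_points F \<longleftrightarrow> eval3 F (x, y, z) = 0"
  using assms(2) proj_point_in_plane[OF assms(2)]
  by (auto simp: curve_points_def proj_point_eq eval3_homogeneous[OF assms(1)] dest: spec[of _ 1])

section \<open>An equation over a finite field\<close>

text \<open>
  Second moment of the number of points of \<open>A \<times> B\<close> on the line \<open>y = w - s x\<close>, over all \<open>(s, w)\<close>:
  two points with distinct first coordinate lie on exactly one such line.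
\<close>

lemma card_bound_if_no_solution:
  fixes S A B W :: "'a::{field, finite} set"
  assumes none: "\<And>s x y. s \<in> S \<Longrightarrow> x \<in> A \<Longrightarrow> y \<in> B \<Longrightarrow> s * x + y \<notin> W"
  shows "int (card S * card W * (card A * card B)) \<le>
    int CARD('a) ^ 2 * (int CARD('a) - int (card B))"
\<comment> \<open>The estimate is finally divided by \<open>N\<close>, so the case
  \<open>N = 0\<close> is treated apart.\<close>
proof (cases "A = {} \<or> B = {}")
  case True
  have "card B \<le> CARD('a)"
    by (rule card_mono) auto
  with True show ?thesis
    by auto
next
  case False
  define q where "q = int CARD('a)"
  define P where "P = A \<times> B"
  define N where "N = int (card P)"
  define hit :: "'a \<times> 'a \<Rightarrow> 'a \<times> 'a \<Rightarrow> int" where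
    "hit l p = of_bool (snd l = fst l * fst p + snd p)" for l p
  define n where "n l = (\<Sum>p\<in>P. hit l p)" for l
  have N: "N = int (card A) * int (card B)" "N > 0"
    using False by (auto simp: N_def P_def card_gt_0_iff)
  \<comment> \<open>The number of lines through both points: 1 for distinct first coordinates, 0 if
    only the first coordinates agree, and \<open>q\<close> if the points coincide.\<close>
  have common: "(\<Sum>l\<in>UNIV. hit l p * hit l p') =
      1 - of_bool (fst p = fst p') + q * of_bool (p = p')" for p p'
  proof -
    obtain x y x' y' where p: "p = (x, y)" "p' = (x', y')"
      by (cases p, cases p') auto
    have "(\<Sum>l\<in>UNIV. hit l p * hit l p') =
        int (card {l. snd l = fst l * x + y \<and> snd l = fst l * x' + y'})"
      by (simp add: hit_def p flip: of_bool_conj)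
    also have "\<dots> = 1 - of_bool (fst p = fst p') + q * of_bool (p = p')"
    proof (cases "x = x'")
      case True
      show ?thesis
      proof (cases "y = y'")
        case True
        have "{l. snd l = fst l * x + y} = range (\<lambda>s. (s, s * x + y))"
          by auto
        then show ?thesis
          using \<open>x = x'\<close> True by (simp add: p q_def card_image inj_on_def)
      next
        case False
        then show ?thesis
          using \<open>x = x'\<close> by (auto simp: p card_eq_0_iff)
      qed
    next
      case False
      define s where "s = (y' - y) / (x - x')"
      have "s * x + y = s * x' + y'"
        using False by (simp add: s_def field_simps)
      moreover have "t = s" if "t * x + y = t * x' + y'" for t
      proof -
        have "t * (x - x') = y' - y"
          using that by (simp add: algebra_simps)
        then show ?thesis
          using False by (simp add: s_def field_simps)
      qed
      ultimately have meet: "t * x + y = t * x' + y' \<longleftrightarrow> t = s" for t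
        by blast
      have "{l. snd l = fst l * x + y \<and> snd l = fst l * x' + y'} = {(s, s * x + y)}"
        by (auto simp: meet)
      then show ?thesis
        using False by (simp add: p)
    qed
    finally show ?thesis .
  qed
  have first: "(\<Sum>l\<in>UNIV. n l) = q * N"
  proof -
    have "(\<Sum>l\<in>UNIV. hit l p) = q" for p
      using common[of p p] by (simp add: hit_def flip: of_bool_conj)
    then show ?thesis
      unfolding n_def by (subst sum.swap) (simp add: N_def)
  qed
  have second: "(\<Sum>l\<in>UNIV. n l ^ 2) = N\<^sup>2 - N * int (card B) + q * N"
  proof -
    have "(\<Sum>l\<in>UNIV. n l ^ 2) = (\<Sum>l\<in>UNIV. \<Sum>p\<in>P. \<Sum>p'\<in>P. hit l p * hit l p')"
      by (simp add: n_def power2_eq_square sum_product)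
    also have "\<dots> = (\<Sum>p\<in>P. \<Sum>l\<in>UNIV. \<Sum>p'\<in>P. hit l p * hit l p')"
      by (rule sum.swap)
    also have "\<dots> = (\<Sum>p\<in>P. \<Sum>p'\<in>P. \<Sum>l\<in>UNIV. hit l p * hit l p')"
      by (intro sum.cong refl sum.swap)
    \<comment> \<open>For fixed \<open>p\<close>, the \<open>card B\<close> points above the same
      first coordinate lose their 1, and \<open>p\<close> itself gains \<open>q\<close>.\<close>
    also have "\<dots> = (\<Sum>p\<in>P. N - int (card B) + q)"
    proof (intro sum.cong refl)
      fix p assume p: "p \<in> P"
      have "{p' \<in> P. fst p = fst p'} = {fst p} \<times> B"
        using p by (auto simp: P_def)
      then have "(\<Sum>p'\<in>P. of_bool (fst p = fst p') :: int) = int (card B)"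
        by (simp add: Int_def)
      moreover have "(\<Sum>p'\<in>P. of_bool (p = p') :: int) = 1"
        using p by (simp add: of_bool_def)
      ultimately show "(\<Sum>p'\<in>P. \<Sum>l\<in>UNIV. hit l p * hit l p') = N - int (card B) + q"
        by (simp add: common sum.distrib sum_subtractf N_def flip: sum_distrib_left)
    qed
    also have "\<dots> = N\<^sup>2 - N * int (card B) + q * N"
      by (simp add: N_def algebra_simps power2_eq_square)
    finally show ?thesis .
  qed
  have empty: "n l = 0" if "l \<in> S \<times> W" for l
    using that none by (fastforce simp: n_def hit_def P_def intro!: sum.neutral)
  \<comment> \<open>The mean of \<open>n\<close> over the \<open>q ^ 2\<close> lines is
    \<open>N / q\<close>. The deviations are scaled by \<open>q\<close> to stay in the integers;
    each line in \<open>S \<times> W\<close> misses \<open>P\<close> and contributes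
    \<open>N ^ 2\<close>.\<close>
  have "int (card S * card W) * N\<^sup>2 = (\<Sum>l\<in>S \<times> W. (q * n l - N)\<^sup>2)"
    by (simp add: empty)
  also have "\<dots> \<le> (\<Sum>l\<in>UNIV. (q * n l - N)\<^sup>2)"
    by (intro sum_mono2) auto
  also have "\<dots> = (\<Sum>l\<in>UNIV. q\<^sup>2 * n l ^ 2 - 2 * q * N * n l + N\<^sup>2)"
    by (simp add: power2_eq_square algebra_simps)
  also have "\<dots> = q\<^sup>2 * (\<Sum>l\<in>UNIV. n l ^ 2) - 2 * q * N * (\<Sum>l\<in>UNIV. n l) + q\<^sup>2 * N\<^sup>2"
    by (simp add: sum.distrib sum_subtractf q_def power2_eq_square flip: sum_distrib_left)
  also have "\<dots> = q\<^sup>2 * (q - int (card B)) * N"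
    unfolding first second by (simp add: power2_eq_square algebra_simps)
  finally have "(int (card S * card W) * N) * N \<le> (q\<^sup>2 * (q - int (card B))) * N"
    by (simp add: power2_eq_square mult_ac)
  then have "int (card S * card W) * N \<le> q\<^sup>2 * (q - int (card B))"
    using N(2) by (rule mult_right_le_imp_le)
  then show ?thesis
    by (simp add: N(1) q_def)
qed

text \<open>Nonzero \<open>r\<close>-th powers lie in \<open>H\<close>, as
  \<open>x ^ (r * m) = 1\<close>. There are at least \<open>m\<close> of them, since each is hit at
  most \<open>r\<close> times by the \<open>r * m\<close> nonzero elements, while \<open>H\<close>
  has at most \<open>m\<close> elements.\<close>

lemma card_roots_of_unity:
  fixes r m :: nat
  assumes q: "CARD('a::finite_field) = r * m + 1" and "r > 0" "m > 0"
  defines "H \<equiv> {u::'a. u ^ m = 1}"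
  shows "card H = m" and "H = (\<lambda>x. x ^ r) ` (UNIV - {0})"
proof -
  let ?R = "(\<lambda>x. x ^ r) ` (UNIV - {0::'a})"
  have roots: "card {x::'a. x ^ n = u} \<le> n" if "n > 0" for n u
  proof -
    let ?p = "Polynomial.monom 1 n - [:u:]"
    have "degree ?p = n"
      using that by (simp add: diff_conv_add_uminus degree_add_eq_left degree_monom_eq
          del: add_uminus_conv_diff)
    moreover have "?p \<noteq> 0"
      using that calculation by auto
    moreover have "{x::'a. poly ?p x = 0} = {x. x ^ n = u}"
      by (simp add: poly_monom)
    ultimately show ?thesis
      using card_poly_roots_bound[of ?p] by simp
  qed
  have sub: "?R \<subseteq> H"
  proof
    fix u assume "u \<in> ?R"
    then obtain x where x: "x \<noteq> 0" "u = x ^ r"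
      by auto
    have "x * x ^ (r * m) = x"
      using finite_field_power_card_eq_same[of x] by (simp add: q)
    with x show "u \<in> H"
      by (simp add: H_def flip: power_mult)
  qed
  have "r * m = card (UNIV - {0::'a})"
    by (simp add: card_Diff_singleton q)
  also have "\<dots> = card (\<Union>u\<in>?R. {x. x ^ r = u})"
    using \<open>r > 0\<close> by (intro arg_cong[of _ _ card]) (auto simp: power_0_left)
  also have "\<dots> \<le> (\<Sum>u\<in>?R. card {x. x ^ r = u})"
    by (rule card_UN_le) simp
  also have "\<dots> \<le> r * card ?R"
    using sum_bounded_above[of ?R "\<lambda>u. card {x. x ^ r = u}" r] roots[OF \<open>r > 0\<close>]
    by (simp add: mult.commute)
  finally have "m \<le> card ?R"
    using \<open>r > 0\<close> by simp
  moreover have "card H \<le> m"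
    using roots[OF \<open>m > 0\<close>] by (simp add: H_def)
  moreover have "card ?R \<le> card H"
    using sub by (intro card_mono) auto
  ultimately show "card H = m" "H = ?R"
    using card_subset_eq[OF _ sub] by auto
qed

lemma exponent_bounds:
  fixes r m :: nat
  assumes "r ^ 4 < r * m + 1" "r \<ge> 2"
  shows "r ^ 3 \<le> m" and "m \<ge> 8"
proof -
  have "r * r ^ 3 = r ^ 4"
    by (simp flip: power_Suc)
  with assms have "r * r ^ 3 \<le> r * m"
    by simp
  with assms(2) show "r ^ 3 \<le> m"
    by simp
  moreover have "(2::nat) ^ 3 \<le> r ^ 3"
    using assms(2) by (rule power_mono) simp
  ultimately show "m \<ge> 8"
    by simp
qed

text \<open>The moment bound is applied to \<open>H\<close> and its multiples by \<open>a\<close>,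
  \<open>b\<close>, \<open>- c\<close>, all of size \<open>m\<close>. Without a solution it gives
  \<open>m ^ 4 \<le> q ^ 2 * (q - m)\<close>, which contradicts
  \<open>r ^ 3 \<le> m\<close>.\<close>

lemma linear_equation_in_roots_of_unity:
  fixes a b c :: "'a::finite_field" and r m :: nat
  assumes q: "CARD('a) = r * m + 1" and r: "r \<ge> 2" and large: "CARD('a) > r ^ 4"
    and nz: "a \<noteq> 0" "b \<noteq> 0" "c \<noteq> 0"
  obtains u v w where "u ^ m = 1" "v ^ m = 1" "w ^ m = 1" "a * u + b * v + c * w = 0"
proof -
  define H where "H = {u::'a. u ^ m = 1}"
  note m = exponent_bounds[OF large[unfolded q] r]
  have cardH: "card H = m"
    unfolding H_def by (rule card_roots_of_unity(1)[OF q]) (use r m(2) in auto)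
  have scaled: "card ((*) t ` H) = m" if "t \<noteq> 0" for t
    using that by (simp add: card_image inj_on_def cardH)
  \<comment> \<open>The first root is split as a product of two roots, so that one of them can join
    \<open>a\<close> in the slope; \<open>H\<close> is closed under multiplication, so they are
    merged again afterwards.\<close>
  have "\<exists>s\<in>(*) a ` H. \<exists>u\<in>H. \<exists>y\<in>(*) b ` H. s * u + y \<in> (*) (- c) ` H"
  proof (rule ccontr)
    assume "\<not> ?thesis"
    then have "int (card ((*) a ` H) * card ((*) (- c) ` H) * (card H * card ((*) b ` H))) \<le>
        int CARD('a) ^ 2 * (int CARD('a) - int (card ((*) b ` H)))"
      by (intro card_bound_if_no_solution) blast
    then have "int (m * m * (m * m)) \<le> int CARD('a) ^ 2 * (int CARD('a) - int m)"
      by (simp only: scaled[of a] scaled[of b] scaled[of "- c"] nz cardH neg_equal_0_iff_equal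
          not_False_eq_True)
    then have "int m ^ 4 \<le> (int r * int m + 1) ^ 2 * (int r * int m + 1 - int m)"
      by (simp add: q power_numeral_reduce mult_ac add_ac)
    moreover have "(int r * int m) ^ 3 \<le> int m ^ 4"
    proof -
      have "int r ^ 3 * int m ^ 3 \<le> int m * int m ^ 3"
        using m(1) by (intro mult_right_mono) (simp_all flip: of_nat_power)
      then show ?thesis
        by (simp add: power_mult_distrib flip: power_Suc)
    qed
    moreover have "int r * int m > 0"
      using r m(2) by simp
    \<comment> \<open>Meant for \<open>t = r * m = q - 1\<close>. As \<open>m \<ge> 8\<close>, the
      left side is at most
      \<open>(t + 1) ^ 2 * (t - 7) = t ^ 3 - 5 * t ^ 2 - 13 * t - 7\<close>.\<close>
    moreover have "(t + 1) ^ 2 * (t + 1 - int m) < t ^ 3" if "t > 0" for t :: int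
    proof -
      have "(t + 1) ^ 2 * (t + 1 - int m) \<le> (t + 1) ^ 2 * (t - 7)"
        using m(2) by (intro mult_left_mono) auto
      also have "\<dots> < t ^ 3"
        using that by (simp add: power_numeral_reduce algebra_simps)
          (smt (verit) mult_pos_pos)
      finally show ?thesis .
    qed
    ultimately show False
      by (meson leD le_less_trans order_trans)
  qed
  then obtain s u v w where "s \<in> H" "u \<in> H" "v \<in> H" "w \<in> H" "a * s * u + b * v = - c * w"
    by auto
  then show ?thesis
    by (intro that[of "s * u" v w]) (auto simp: H_def power_mult_distrib algebra_simps)
qed

section \<open>The curve\<close>

text \<open>\<open>M\<close> stands for the image of \<open>Suc n\<close> in the field, and
  \<open>Fx\<close> is the negated derivative. \<open>Fx\<close> leaves \<open>x = 0\<close> or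
  \<open>z = - k y\<close>. In the first case with \<open>y\<close>, \<open>z\<close> nonzero,
  \<open>Fy\<close> and \<open>Fz\<close> are linear in \<open>y ^ n\<close> and
  \<open>k * z ^ n\<close> with determinant \<open>M ^ 2 - 1\<close>; in the second,
  \<open>F\<close> forces \<open>(- k) ^ Suc n = 1\<close>.\<close>

lemma curve_nonsingular:
  fixes x y z k M :: "'a::field"
  assumes "n > 0" "k \<noteq> 0" "M \<noteq> 0" "M ^ 2 \<noteq> 1" "(- k) ^ Suc n \<noteq> 1"
    and F: "- (k * y + z) * x ^ Suc n + z * y ^ Suc n + k * y * z ^ Suc n = 0"
    and Fx: "M * (k * y + z) * x ^ n = 0"
    and Fy: "- k * x ^ Suc n + M * z * y ^ n + k * z ^ Suc n = 0"
    and Fz: "y ^ Suc n - x ^ Suc n + M * k * y * z ^ n = 0"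
  shows "x = 0 \<and> y = 0 \<and> z = 0"
proof (cases "x = 0")
  case True
  show ?thesis
  proof (cases "y = 0 \<or> z = 0")
    case True
    then show ?thesis
      using Fy Fz \<open>x = 0\<close> \<open>n > 0\<close> \<open>k \<noteq> 0\<close> by (auto simp: power_0_left)
  next
    case False
    have "z * (M * y ^ n + k * z ^ n) = 0" "y * (y ^ n + M * k * z ^ n) = 0"
      using Fy Fz \<open>x = 0\<close> by (simp_all add: algebra_simps)
    then have 1: "M * y ^ n + k * z ^ n = 0" and 2: "y ^ n + M * k * z ^ n = 0"
      using False by simp_all
    have "(M ^ 2 - 1) * (k * z ^ n) =
        M * (y ^ n + M * k * z ^ n) - (M * y ^ n + k * z ^ n)"
      by (simp add: algebra_simps power2_eq_square)
    also have "\<dots> = 0"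
      by (simp only: 1 2) simp
    finally show ?thesis
      using False \<open>k \<noteq> 0\<close> \<open>M ^ 2 \<noteq> 1\<close> by simp
  qed
next
  case False
  then have kyz: "k * y + z = 0"
    using Fx \<open>M \<noteq> 0\<close> by simp
  then have z: "z = - k * y"
    by (simp add: eq_neg_iff_add_eq_0 add.commute)
  \<comment> \<open>Otherwise \<open>z = 0\<close> as well, and \<open>Fz\<close> reduces to
    \<open>x ^ Suc n = 0\<close>.\<close>
  have "y \<noteq> 0"
    using Fz z False by auto
  have "k * y * (z ^ Suc n - y ^ Suc n) =
      (- (k * y + z) * x ^ Suc n + z * y ^ Suc n + k * y * z ^ Suc n) -
      (k * y + z) * (y ^ Suc n - x ^ Suc n)"
    by (simp add: algebra_simps)
  also have "\<dots> = 0"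
    using F kyz by (simp del: power_Suc)
  finally have "k * y * (z ^ Suc n - y ^ Suc n) = 0" .
  then have "z ^ Suc n = y ^ Suc n"
    using \<open>y \<noteq> 0\<close> \<open>k \<noteq> 0\<close> by simp
  then have "(- k) ^ Suc n * y ^ Suc n = y ^ Suc n"
    by (simp only: z power_mult_distrib)
  then show ?thesis
    using assms(5) \<open>y \<noteq> 0\<close> by (simp del: power_Suc)
qed

theorem theorem6p3:
  fixes k :: "'a::finite_field" and r q p m :: nat and F :: "'a poly3"
  assumes "r \<ge> 2"
    and "q = CARD('a)"
    and "[q = 1] (mod r)"
    and "p = CHAR('a)"
    and "q > r ^ 4"
    and "\<not> p dvd r ^ 2 - 1"
    and "k \<noteq> 0"
    and "\<not> (\<exists>b::'a. b \<noteq> 0 \<and> b ^ r = - k)"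
    and "m = (q - 1) div r"
    and "F = - (Const k * VarY + VarZ) * VarX ^ m + VarZ * VarY ^ m + Const k * VarY * VarZ ^ m"
  shows "plane_curve F \<and> smooth_curve F \<and> nontrivially_blocking F"
proof -
  have q_gt: "q > 1"
    using assms(1,5) zero_less_power[of r 4] by linarith
  have "r dvd q - 1"
    using assms(3) q_gt by (metis cong_to_1_nat)
  then have q: "CARD('a) = r * m + 1"
    using q_gt assms(2,9) by simp
  have m8: "m \<ge> 8"
    using exponent_bounds(2)[of r m] assms(1,2,5) q by simp
  then have pow0 [simp]: "0 ^ m = (0 :: 'a)"
    by simp
  \<comment> \<open>Writing \<open>m\<close> as \<open>Suc n\<close> keeps truncated subtraction out
    of the exponents of the derivatives.\<close>
  define n where "n = m - 1"
  have n: "m = Suc n" "n > 0"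
    using m8 by (simp_all add: n_def)

  have k_power: "(- k) ^ m \<noteq> 1"
  proof
    assume "(- k) ^ m = 1"
    then have "- k \<in> (\<lambda>x. x ^ r) ` (UNIV - {0})"
      using card_roots_of_unity(2)[OF q] assms(1) m8 by auto
    with assms(8) show False
      by (metis DiffE imageE singletonI)
  qed

  have "of_nat (r * m + 1) = (0 :: 'a)"
    using CHAR_dvd_CARD[where 'a = 'a] by (metis q of_nat_eq_0_iff_char_dvd)
  then have rm: "of_nat r * of_nat m = (- 1 :: 'a)"
    by (simp add: eq_neg_iff_add_eq_0 add.commute)
  then have m0: "of_nat m \<noteq> (0 :: 'a)"
    by (metis mult_zero_right neg_equal_0_iff_equal one_neq_zero)
  \<comment> \<open>Squaring \<open>r * m = - 1\<close> would give \<open>r ^ 2 = 1\<close> in the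
    field, that is, \<open>p\<close> divides \<open>r ^ 2 - 1\<close>.\<close>
  have m1: "(of_nat m)\<^sup>2 \<noteq> (1 :: 'a)"
  proof
    assume "(of_nat m)\<^sup>2 = (1 :: 'a)"
    then have "(of_nat r)\<^sup>2 = (of_nat r * of_nat m :: 'a)\<^sup>2"
      by (simp add: power_mult_distrib)
    then have "of_nat (r\<^sup>2 - 1) = (0 :: 'a)"
      using assms(1) by (simp add: rm of_nat_diff)
    with assms(4,6) show False
      by (simp add: of_nat_eq_0_iff_char_dvd)
  qed

  \<comment> \<open>As a sum of monomials, \<open>F\<close> can be evaluated, differentiated and
    base changed term by term.\<close>
  have F: "F = Poly_Mapping.single (m, 1, 0) (- k) + Poly_Mapping.single (m, 0, 1) (- 1) +
      Poly_Mapping.single (0, m, 1) 1 + Poly_Mapping.single (0, 1, m) k"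
    unfolding assms(10) Const_def VarX_def VarY_def VarZ_def
    by (simp add: single_power mult_single algebra_simps single_uminus)
  have hom: "homogeneous3 (m + 1) F"
    unfolding F by (intro homogeneous3_add homogeneous3_single) simp_all
  have ev: "eval3 F (x, y, z) = - (k * y + z) * x ^ m + z * y ^ m + k * y * z ^ m" for x y z
    by (simp add: F eval3_add eval3_single algebra_simps)

  have "eval3 F (1, 1, 0) \<noteq> 0"
    using assms(7) by (simp add: ev)
  then have "F \<noteq> 0"
    by (auto simp: eval3_def)
  then have curve: "plane_curve F"
    using hom by (auto simp: plane_curve_def)

  have smooth: "smooth_curve F"
    unfolding smooth_curve_def
  proof (intro ballI)
    fix P v
    let ?G = "base_change F"
    let ?k = "to_ac k"
    assume P: "P \<in> curve_points ?G" and v: "v \<in> P"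
    obtain x y z where xyz: "v = (x, y, z)"
      by (cases v)
    have nz: "(x, y, z) \<noteq> (0, 0, 0)" and zero: "eval3 ?G (x, y, z) = 0"
      using P v coordinates_nonzero[of v P] by (auto simp: curve_points_def xyz)
    have G: "?G = Poly_Mapping.single (m, 1, 0) (- ?k) + Poly_Mapping.single (m, 0, 1) (- 1) +
        Poly_Mapping.single (0, m, 1) 1 + Poly_Mapping.single (0, 1, m) ?k"
      by (simp add: F base_change_add base_change_single)
    note eval_simps = G deriv_x_add deriv_y_add deriv_z_add deriv_single eval3_add eval3_single
    show "eval3 (deriv_x ?G) v \<noteq> 0 \<or> eval3 (deriv_y ?G) v \<noteq> 0 \<or> eval3 (deriv_z ?G) v \<noteq> 0"
    proof (rule ccontr)
      assume sing: "\<not> ?thesis"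
      let ?M = "of_nat m :: 'a alg_closure"
      have "- (?k * y + z) * x ^ Suc n + z * y ^ Suc n + ?k * y * z ^ Suc n = 0"
        using zero by (simp add: eval_simps n algebra_simps)
      moreover have "eval3 (deriv_x ?G) v = - (?M * (?k * y + z) * x ^ n)"
        by (simp add: eval_simps xyz n algebra_simps)
      with sing have "?M * (?k * y + z) * x ^ n = 0"
        by (simp del: mult_eq_0_iff)
      moreover have "- ?k * x ^ Suc n + ?M * z * y ^ n + ?k * z ^ Suc n = 0"
        using sing by (simp add: eval_simps xyz n algebra_simps)
      moreover have "y ^ Suc n - x ^ Suc n + ?M * ?k * y * z ^ n = 0"
        using sing by (simp add: eval_simps xyz n algebra_simps)
      moreover have "?k \<noteq> 0" "?M \<noteq> 0" "?M ^ 2 \<noteq> 1" "(- ?k) ^ Suc n \<noteq> 1"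
        using assms(7) m0 m1 k_power n(1)
        by (metis to_ac_eq_0_iff to_ac_of_nat to_ac_power to_ac_eq_1_iff to_ac_minus)+
      ultimately have "x = 0 \<and> y = 0 \<and> z = 0"
        using n(2) by (intro curve_nonsingular)
      with nz show False
        by simp
    qed
  qed

  have "\<exists>P. P \<in> line_points (a, b, c) \<inter> curve_points F" if "(a, b, c) \<noteq> (0, 0, 0)" for a b c
  proof -
    have "\<exists>x y z. (x, y, z) \<noteq> (0, 0, 0) \<and> a * x + b * y + c * z = 0 \<and> eval3 F (x, y, z) = 0"
    \<comment> \<open>Every monomial of \<open>F\<close> involves two variables, so the three
      vertices lie on the curve; a vanishing coefficient puts the corresponding vertex on the
      line.\<close>
    proof (cases "a = 0 \<or> b = 0 \<or> c = 0")
      case True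
      then consider "a = 0" | "b = 0" | "c = 0"
        by blast
      then show ?thesis
      proof cases
        case 1
        then show ?thesis
          by (intro exI[of _ 1] exI[of _ 0]) (simp add: ev)
      next
        case 2
        then show ?thesis
          by (intro exI[of _ 0] exI[of _ 1] exI[of _ 0]) (simp add: ev)
      next
        case 3
        then show ?thesis
          by (intro exI[of _ 0] exI[of _ 0] exI[of _ 1]) (simp add: ev)
      qed
    next
      case False
      then obtain u v w where uvw: "u ^ m = 1" "v ^ m = 1" "w ^ m = 1" "a * u + b * v + c * w = 0"
        using linear_equation_in_roots_of_unity[OF q assms(1), of a b c] assms(2,5) by auto
      \<comment> \<open>This makes \<open>(u, v, w)\<close> a projective point; there
        \<open>F\<close> takes the value \<open>- (k * v + w) + w + k * v = 0\<close>.\<close>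
      moreover have "u \<noteq> 0"
        using uvw(1) by auto
      ultimately show ?thesis
        by (intro exI[of _ u] exI[of _ v] exI[of _ w]) (simp add: ev)
    qed
    then show ?thesis
      using proj_point_on_line_iff proj_point_on_curve_iff[OF hom] by blast
  qed
  then have blocking: "blocking_set (curve_points F)"
    by (fastforce simp: blocking_set_def lines_def curve_points_def)

  have "\<not> line_points (a, b, c) \<subseteq> curve_points F" if abc: "(a, b, c) \<noteq> (0, 0, 0)" for a b c
  proof
    assume sub: "line_points (a, b, c) \<subseteq> curve_points F"
    have zero: "eval3 F (x, y, z) = 0"
      if "(x, y, z) \<noteq> (0, 0, 0)" "a * x + b * y + c * z = 0" for x y z
      using that sub proj_point_on_line_iff proj_point_on_curve_iff[OF hom] by blast
    \<comment> \<open>On the line \<open>z = - k y\<close> the term in \<open>x ^ m\<close> drops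
      out, and \<open>F\<close> equals \<open>k * y ^ (m + 1) * ((- k) ^ m - 1)\<close>.\<close>
    have off: "y = 0" if "eval3 F (x, y, - k * y) = 0" for x y
    proof -
      have "k * y * (y ^ m * ((- k) ^ m - 1)) = 0"
        using that by (simp add: ev power_mult_distrib algebra_simps flip: power_mult_distrib)
      then show ?thesis
        using assms(7) k_power by auto
    qed
    have "a = 0"
    proof (rule ccontr)
      assume "a \<noteq> 0"
      \<comment> \<open>The cross product of \<open>(a, b, c)\<close> and \<open>(0, k, 1)\<close>:
        the point where the given line meets \<open>z = - k y\<close>.\<close>
      then have "eval3 F (b - k * c, - a, - k * (- a)) = 0"
        by (intro zero) (auto simp: algebra_simps)
      then have "- a = 0"
        by (rule off)
      with \<open>a \<noteq> 0\<close> show False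
        by simp
    qed
    \<comment> \<open>Two points of \<open>b y + c z = 0\<close> that differ only in
      \<open>x\<close>; their values under \<open>F\<close> differ by \<open>k * c - b\<close> up to
      sign, which therefore vanishes.\<close>
    then have 0: "eval3 F (0, c, - b) = 0" and 1: "eval3 F (1, c, - b) = 0"
      using abc by (auto intro!: zero)
    have b: "b = k * c"
      using 0 1 by (simp add: ev)
    then have "c = 0"
      using off[of 0 c] 0 by simp
    with b \<open>a = 0\<close> abc show False
      by simp
  qed
  then have "nontrivially_blocking F"
    using blocking by (auto simp: nontrivially_blocking_def nontrivial_blocking_set_def lines_def)
  with curve smooth show ?thesis
    by blast
qed

end
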